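(* $\mathrm{SAT}(\aleph_1)$ implies the Continuum Hypothesis $2^{\aleph_0}=\aleph_1$.
   Context: All ultrafilters are nonprincipal. For a cardinal $\kappa$, $\mathrm{SAT}(\kappa)$ is the statement: there exists a nonprincipal ultrafilter $U$ over $\omega$ such that for every countable first-order language $L$ and every sequence $(\mathcal{A}_i)_{i\in\omega}$ of $L$-structures each of size $\le\kappa$, the ultraproduct $\prod_{i\in\omega}\mathcal{A}_i/U$ is saturated (i.e. $|M|$-saturated where $M$ is the ultraproduct: every type over fewer than $|M|$ parameters that is finitely satisfiable in $M$ is realized in $M$). *)

theory Defs
  imports Main "HOL-Library.FuncSet"
begin

unbundle cardinal_syntax

section \<open>First-order languages and structures\<close>

text \<open>Constant symbols are function symbols of arity 0.\<close>

record ('f, 'r) language =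
  funs :: "'f set"
  rels :: "'r set"
  fun_arity :: "'f \<Rightarrow> nat"
  rel_arity :: "'r \<Rightarrow> nat"

datatype 'f fo_term = Var nat | App 'f "'f fo_term list"

datatype ('f, 'r) formula =
    Eq "'f fo_term" "'f fo_term"
  | Rel 'r "'f fo_term list"
  | Neg "('f, 'r) formula"
  | Conj "('f, 'r) formula" "('f, 'r) formula"
  | Ex nat "('f, 'r) formula"

fun wf_term :: "('f, 'r) language \<Rightarrow> 'f fo_term \<Rightarrow> bool" where
  "wf_term L (Var x) \<longleftrightarrow> True"
| "wf_term L (App f ts) \<longleftrightarrow>
     f \<in> funs L \<and> length ts = fun_arity L f \<and> (\<forall>t\<in>set ts. wf_term L t)"

fun wf_formula :: "('f, 'r) language \<Rightarrow> ('f, 'r) formula \<Rightarrow> bool" where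
  "wf_formula L (Eq s t) \<longleftrightarrow> wf_term L s \<and> wf_term L t"
| "wf_formula L (Rel r ts) \<longleftrightarrow>
     r \<in> rels L \<and> length ts = rel_arity L r \<and> (\<forall>t\<in>set ts. wf_term L t)"
| "wf_formula L (Neg \<phi>) \<longleftrightarrow> wf_formula L \<phi>"
| "wf_formula L (Conj \<phi> \<psi>) \<longleftrightarrow> wf_formula L \<phi> \<and> wf_formula L \<psi>"
| "wf_formula L (Ex x \<phi>) \<longleftrightarrow> wf_formula L \<phi>"

fun term_vars :: "'f fo_term \<Rightarrow> nat set" where
  "term_vars (Var x) = {x}"
| "term_vars (App f ts) = (\<Union>t\<in>set ts. term_vars t)"

fun free_vars :: "('f, 'r) formula \<Rightarrow> nat set" where
  "free_vars (Eq s t) = term_vars s \<union> term_vars t"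
| "free_vars (Rel r ts) = (\<Union>t\<in>set ts. term_vars t)"
| "free_vars (Neg \<phi>) = free_vars \<phi>"
| "free_vars (Conj \<phi> \<psi>) = free_vars \<phi> \<union> free_vars \<psi>"
| "free_vars (Ex x \<phi>) = free_vars \<phi> - {x}"

record ('f, 'r, 'm) fo_struct =
  dom :: "'m set"
  fun_int :: "'f \<Rightarrow> 'm list \<Rightarrow> 'm"
  rel_int :: "'r \<Rightarrow> 'm list \<Rightarrow> bool"

text \<open>The interpretations are total on the types; only their values at symbols of the language
  and at argument tuples of the right length from the domain are ever relevant.\<close>

definition is_structure :: "('f, 'r) language \<Rightarrow> ('f, 'r, 'm) fo_struct \<Rightarrow> bool" where
  "is_structure L M \<longleftrightarrow>
     dom M \<noteq> {} \<and>
     (\<forall>f\<in>funs L. \<forall>xs. length xs = fun_arity L f \<and> set xs \<subseteq> dom M \<longrightarrow> fun_int M f xs \<in> dom M)"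

fun eval :: "('f, 'r, 'm) fo_struct \<Rightarrow> (nat \<Rightarrow> 'm) \<Rightarrow> 'f fo_term \<Rightarrow> 'm" where
  "eval M v (Var x) = v x"
| "eval M v (App f ts) = fun_int M f (map (eval M v) ts)"

fun sat :: "('f, 'r, 'm) fo_struct \<Rightarrow> (nat \<Rightarrow> 'm) \<Rightarrow> ('f, 'r) formula \<Rightarrow> bool" where
  "sat M v (Eq s t) \<longleftrightarrow> eval M v s = eval M v t"
| "sat M v (Rel r ts) \<longleftrightarrow> rel_int M r (map (eval M v) ts)"
| "sat M v (Neg \<phi>) \<longleftrightarrow> \<not> sat M v \<phi>"
| "sat M v (Conj \<phi> \<psi>) \<longleftrightarrow> sat M v \<phi> \<and> sat M v \<psi>"
| "sat M v (Ex x \<phi>) \<longleftrightarrow> (\<exists>a\<in>dom M. sat M (v(x := a)) \<phi>)"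

section \<open>Types and saturation\<close>

text \<open>The language \<open>L(A)\<close>, which has a new constant symbol \<open>Inr a\<close> for each parameter \<open>a \<in> A\<close>,
  and the corresponding expansion of a structure, in which \<open>Inr a\<close> denotes \<open>a\<close>.\<close>

definition lang_params :: "('f, 'r) language \<Rightarrow> 'm set \<Rightarrow> ('f + 'm, 'r) language" where
  "lang_params L A =
     \<lparr> funs = Inl ` funs L \<union> Inr ` A, rels = rels L,
       fun_arity = case_sum (fun_arity L) (\<lambda>_. 0), rel_arity = rel_arity L \<rparr>"

definition struct_params :: "('f, 'r, 'm) fo_struct \<Rightarrow> ('f + 'm, 'r, 'm) fo_struct" where
  "struct_params M =
     \<lparr> dom = dom M, fun_int = case_sum (fun_int M) (\<lambda>a _. a), rel_int = rel_int M \<rparr>"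

text \<open>The free variable of a type is the variable \<open>0\<close>. The values that the constant assignment
  \<open>\<lambda>_. b\<close> gives to the other variables are irrelevant.\<close>

definition one_var_formulas ::
    "('f, 'r) language \<Rightarrow> 'm set \<Rightarrow> ('f + 'm, 'r) formula set" where
  "one_var_formulas L A = {\<phi>. wf_formula (lang_params L A) \<phi> \<and> free_vars \<phi> \<subseteq> {0}}"

definition realizes ::
    "('f, 'r, 'm) fo_struct \<Rightarrow> 'm \<Rightarrow> ('f + 'm, 'r) formula set \<Rightarrow> bool" where
  "realizes M b p \<longleftrightarrow> (\<forall>\<phi>\<in>p. sat (struct_params M) (\<lambda>_. b) \<phi>)"

definition finitely_satisfiable ::
    "('f, 'r, 'm) fo_struct \<Rightarrow> ('f + 'm, 'r) formula set \<Rightarrow> bool" where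
  "finitely_satisfiable M p \<longleftrightarrow>
     (\<forall>q. q \<subseteq> p \<and> finite q \<longrightarrow> (\<exists>b\<in>dom M. realizes M b q))"

definition card_saturated ::
    "('f, 'r) language \<Rightarrow> 'k rel \<Rightarrow> ('f, 'r, 'm) fo_struct \<Rightarrow> bool" where
  "card_saturated L \<kappa> M \<longleftrightarrow>
     (\<forall>A p. A \<subseteq> dom M \<and> |A| <o \<kappa> \<and> p \<subseteq> one_var_formulas L A \<and> finitely_satisfiable M p
        \<longrightarrow> (\<exists>b\<in>dom M. realizes M b p))"

definition saturated :: "('f, 'r) language \<Rightarrow> ('f, 'r, 'm) fo_struct \<Rightarrow> bool" where
  "saturated L M \<longleftrightarrow> card_saturated L |dom M| M"

section \<open>Ultraproducts\<close>

definition nonprincipal_ultrafilter :: "'i filter \<Rightarrow> bool" where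
  "nonprincipal_ultrafilter U \<longleftrightarrow>
     U \<noteq> bot \<and>
     (\<forall>P. eventually P U \<or> eventually (\<lambda>i. \<not> P i) U) \<and>
     (\<forall>i. U \<noteq> principal {i})"

definition ultra_rel ::
    "'i filter \<Rightarrow> ('i \<Rightarrow> ('f, 'r, 'm) fo_struct) \<Rightarrow> ('i \<Rightarrow> 'm) rel" where
  "ultra_rel U \<A> =
     {(x, y). x \<in> (\<Pi> i\<in>UNIV. dom (\<A> i)) \<and> y \<in> (\<Pi> i\<in>UNIV. dom (\<A> i)) \<and>
        eventually (\<lambda>i. x i = y i) U}"

definition rep :: "('i \<Rightarrow> 'm) set \<Rightarrow> 'i \<Rightarrow> 'm" where
  "rep c = (SOME x. x \<in> c)"

definition ultraproduct ::
    "'i filter \<Rightarrow> ('i \<Rightarrow> ('f, 'r, 'm) fo_struct) \<Rightarrow> ('f, 'r, ('i \<Rightarrow> 'm) set) fo_struct" where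
  "ultraproduct U \<A> =
     \<lparr> dom = (\<Pi> i\<in>UNIV. dom (\<A> i)) // ultra_rel U \<A>,
       fun_int = (\<lambda>f cs. ultra_rel U \<A> `` {\<lambda>i. fun_int (\<A> i) f (map (\<lambda>c. rep c i) cs)}),
       rel_int = (\<lambda>r cs. eventually (\<lambda>i. rel_int (\<A> i) r (map (\<lambda>c. rep c i) cs)) U) \<rparr>"

section \<open>The principle SAT\<close>

text \<open>Quantification over all countable languages and over all structures of size at most \<open>\<kappa>\<close>
  is up to renaming of symbols and up to isomorphism: the symbols of a countable language may be
  taken to be natural numbers, and since \<open>\<kappa>\<close> is a relation on the type \<open>'k\<close>, every structure
  of size at most \<open>\<kappa>\<close> has an isomorphic copy whose domain is a subset of \<open>'k\<close>.\<close>

definition SAT :: "'k rel \<Rightarrow> bool" where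
  "SAT \<kappa> \<longleftrightarrow>
     (\<exists>U :: nat filter. nonprincipal_ultrafilter U \<and>
       (\<forall>(L :: (nat, nat) language) (\<A> :: nat \<Rightarrow> (nat, nat, 'k) fo_struct).
          (\<forall>i. is_structure L (\<A> i) \<and> |dom (\<A> i)| \<le>o \<kappa>)
            \<longrightarrow> saturated L (ultraproduct U \<A>)))"

end

theory Submission
  imports Defs "HOL-Library.Nat_Bijection"
begin

text \<open>In an ultrapower \<open>M\<close> of \<open>(\<omega>\<^sub>1, \<le>)\<close> over \<open>\<omega>\<close>, consider the type saying that \<open>x\<close> lies above
  every diagonal element. It is finitely satisfiable, and it has at most \<open>\<aleph>\<^sub>1\<close> parameters. An element
  of \<open>M\<close> is represented by a function \<open>f : \<omega> \<rightarrow> \<omega>\<^sub>1\<close>, whose countable range is bounded since \<open>\<omega>\<^sub>1\<close> is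
  regular; so no element realizes the type. Hence \<open>M\<close> can only be saturated if it has at most
  \<open>\<aleph>\<^sub>1\<close> elements. But \<open>M\<close> has at least \<open>2\<^bsup>\<aleph>\<^sub>0\<^esup>\<close> elements: map \<open>S \<subseteq> \<omega>\<close> to the class of a sequence whose
  \<open>n\<close>-th term codes \<open>S \<inter> {0..<n}\<close>.\<close>

subsection \<open>Cardinals\<close>

lemma continuum_ordIso_Pow_nat: "ctwo ^c natLeq =o |UNIV :: nat set set|"
  using ordIso_symmetric[OF card_of_Pow_Func[of "UNIV :: nat set"]]
  by (simp add: cexp_def ctwo_def Field_natLeq Field_card_of)

lemma cardSuc_ordLeq_ctwo_cexp:
  assumes "Card_order r"
  shows "cardSuc r \<le>o ctwo ^c r"
  using assms Card_order_cexp ordLess_ctwo_cexp[OF assms] by (rule cardSuc_least)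

lemma regularCard_bounded:
  assumes r: "Cinfinite r" "regularCard r"
    and K: "K \<subseteq> Field r" "|K| <o r"
  shows "\<exists>b\<in>Field r. K \<subseteq> underS r b"
proof (rule regularCard_UNION)
  show "K \<subseteq> (\<Union>b\<in>Field r. underS r b)"
  proof
    fix a
    assume "a \<in> K"
    then obtain b where "b \<in> Field r" "a \<noteq> b" "(a, b) \<in> r"
      using K(1) Cinfinite_limit[OF _ r(1)] by blast
    then show "a \<in> (\<Union>b\<in>Field r. underS r b)"
      by (auto simp: underS_def)
  qed
  show "relChain r (underS r)"
    unfolding relChain_def
  proof (intro allI impI subsetI)
    fix i j a
    assume "(i, j) \<in> r" "a \<in> underS r i"
    then show "a \<in> underS r j"
      using r(1) Card_order_trans[of r a i j] by (cases "i = j") (auto simp: underS_def)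
  qed
qed (use r K(2) in auto)

lemma regularCard_range_not_cofinal:
  fixes f :: "'i \<Rightarrow> 'a"
  assumes r: "Cinfinite r" "regularCard r"
    and f: "range f \<subseteq> Field r" "|UNIV :: 'i set| <o r"
  shows "\<exists>a\<in>Field r. \<forall>i. (a, f i) \<notin> r"
proof -
  have "|range f| <o r"
    using card_of_image f(2) by (rule ordLeq_ordLess_trans)
  then obtain a where a: "a \<in> Field r" "range f \<subseteq> underS r a"
    using regularCard_bounded[OF r f(1)] by blast
  have "antisym r"
    using r(1) by (simp add: card_order_on_def well_order_on_def linear_order_on_def
        partial_order_on_def)
  with a(2) have "(a, f i) \<notin> r" for i
    using antisymD[of r a "f i"] by (auto simp: underS_def)
  with a(1) show ?thesis
    by blast
qed

subsection \<open>Nonprincipal ultrafilters\<close>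

lemma nonprincipal_ultrafilter_not_bot: "nonprincipal_ultrafilter U \<Longrightarrow> U \<noteq> bot"
  by (simp add: nonprincipal_ultrafilter_def)

lemma nonprincipal_ultrafilter_eventually_neq:
  assumes U: "nonprincipal_ultrafilter U"
  shows "eventually (\<lambda>j. j \<noteq> i) U"
proof (rule ccontr)
  assume "\<not> eventually (\<lambda>j. j \<noteq> i) U"
  then have ev: "eventually (\<lambda>j. j = i) U"
    using U unfolding nonprincipal_ultrafilter_def by force
  have "principal {i} \<le> U"
  proof (rule filter_leI)
    fix P
    assume "eventually P U"
    with ev have "eventually (\<lambda>_. P i) U"
      by eventually_elim simp
    then show "eventually P (principal {i})"
      using nonprincipal_ultrafilter_not_bot[OF U]
      by (simp add: eventually_const eventually_principal)
  qed
  moreover have "U \<le> principal {i}"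
    using ev by (simp add: le_principal)
  ultimately show False
    using U by (auto simp: nonprincipal_ultrafilter_def)
qed

lemma nonprincipal_ultrafilter_le_cofinite:
  fixes U :: "'i filter"
  assumes "nonprincipal_ultrafilter U"
  shows "U \<le> cofinite"
proof (rule filter_leI)
  fix P :: "'i \<Rightarrow> bool"
  assume "eventually P cofinite"
  then have "finite {i. \<not> P i}"
    by (simp add: eventually_cofinite)
  then have "eventually (\<lambda>j. \<forall>i\<in>{i. \<not> P i}. j \<noteq> i) U"
    using nonprincipal_ultrafilter_eventually_neq[OF assms]
    by (intro eventually_ball_finite ballI)
  then show "eventually P U"
    by (rule eventually_mono) blast
qed

subsection \<open>Elements of ultraproducts\<close>

lemma equiv_ultra_rel: "equiv (\<Pi> i\<in>UNIV. dom (\<A> i)) (ultra_rel U \<A>)"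
proof (rule equivI)
  show "sym (ultra_rel U \<A>)"
    by (auto simp: sym_def ultra_rel_def elim: eventually_mono)
  show "trans (ultra_rel U \<A>)"
    unfolding trans_def ultra_rel_def by (auto elim: eventually_elim2)
qed (auto simp: refl_on_def ultra_rel_def)

lemma ultra_class_in_ultraproduct:
  assumes "x \<in> (\<Pi> i\<in>UNIV. dom (\<A> i))"
  shows "ultra_rel U \<A> `` {x} \<in> dom (ultraproduct U \<A>)"
  using assms by (simp add: ultraproduct_def quotientI)

lemma rep_in_class:
  assumes "c \<in> dom (ultraproduct U \<A>)"
  shows "rep c \<in> c"
  using assms in_quotient_imp_non_empty[OF equiv_ultra_rel]
  by (auto simp: rep_def ultraproduct_def some_in_eq)

lemma rep_in_product:
  assumes "c \<in> dom (ultraproduct U \<A>)"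
  shows "rep c \<in> (\<Pi> i\<in>UNIV. dom (\<A> i))"
  using rep_in_class[OF assms] assms in_quotient_imp_subset[OF equiv_ultra_rel]
  by (fastforce simp: ultraproduct_def)

lemma rep_class_eventually_eq:
  assumes "x \<in> (\<Pi> i\<in>UNIV. dom (\<A> i))"
  shows "eventually (\<lambda>i. rep (ultra_rel U \<A> `` {x}) i = x i) U"
  using rep_in_class[OF ultra_class_in_ultraproduct[OF assms, of U]]
  by (auto simp: ultra_rel_def elim: eventually_mono)

subsection \<open>The size of ultraproducts\<close>

lemma card_of_ordLeq_ultraproduct:
  assumes x: "\<And>s. s \<in> S \<Longrightarrow> x s \<in> (\<Pi> i\<in>UNIV. dom (\<A> i))"
    and neq: "\<And>s t. s \<in> S \<Longrightarrow> t \<in> S \<Longrightarrow> s \<noteq> t \<Longrightarrow> \<not> eventually (\<lambda>i. x s i = x t i) U"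
  shows "|S| \<le>o |dom (ultraproduct U \<A>)|"
proof -
  have "inj_on (\<lambda>s. ultra_rel U \<A> `` {x s}) S"
  proof (rule inj_onI, rule ccontr)
    fix s t
    assume st: "s \<in> S" "t \<in> S" "s \<noteq> t"
      and eq: "ultra_rel U \<A> `` {x s} = ultra_rel U \<A> `` {x t}"
    have "(x s, x t) \<in> ultra_rel U \<A>"
      using eq_equiv_class[OF eq equiv_ultra_rel x[OF st(2)]] .
    then show False
      using neq[OF st] by (simp add: ultra_rel_def)
  qed
  moreover have "(\<lambda>s. ultra_rel U \<A> `` {x s}) ` S \<subseteq> dom (ultraproduct U \<A>)"
    using x by (blast intro: ultra_class_in_ultraproduct)
  ultimately show ?thesis
    using card_of_ordLeq by blast
qed

text \<open>For an ultrafilter \<open>U\<close>, the existence of such a function \<open>g\<close> means that \<open>U\<close> is countably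
  incomplete.\<close>

lemma continuum_ordLeq_ultraproduct:
  fixes g :: "'i \<Rightarrow> nat"
  assumes "U \<noteq> bot" and g: "filterlim g at_top U"
    and inf: "\<And>i. infinite (dom (\<A> i))"
  shows "ctwo ^c natLeq \<le>o |dom (ultraproduct U \<A>)|"
proof -
  have "\<exists>e :: nat \<Rightarrow> _. inj e \<and> range e \<subseteq> dom (\<A> i)" for i
    using inf infinite_countable_subset by blast
  then obtain e :: "'i \<Rightarrow> nat \<Rightarrow> _" where e: "\<And>i. inj (e i)" "\<And>i. range (e i) \<subseteq> dom (\<A> i)"
    by metis
  define code where "code S i = e i (set_encode (S \<inter> {..<g i}))" for S i
  have code_eq_iff: "code S i = code T i \<longleftrightarrow> S \<inter> {..<g i} = T \<inter> {..<g i}" for S T i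
    by (simp add: code_def inj_eq[OF e(1)] set_encode_eq)
  have "\<not> eventually (\<lambda>i. code S i = code T i) U" if neq: "S \<noteq> T" for S T
  proof
    assume eq: "eventually (\<lambda>i. code S i = code T i) U"
    obtain k where k: "k \<in> S \<longleftrightarrow> k \<notin> T"
      using neq by blast
    have "eventually (\<lambda>i. k < g i) U"
      using eventually_gt_at_top g by (rule eventually_compose_filterlim)
    with eq have "eventually (\<lambda>_. False) U"
      unfolding code_eq_iff by eventually_elim (use k in blast)
    with \<open>U \<noteq> bot\<close> show False
      by (simp add: eventually_False)
  qed
  moreover have "code S \<in> (\<Pi> i\<in>UNIV. dom (\<A> i))" for S
    using e(2) by (simp add: code_def range_subsetD)
  ultimately have "|UNIV :: nat set set| \<le>o |dom (ultraproduct U \<A>)|"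
    by (intro card_of_ordLeq_ultraproduct[of _ code])
  with continuum_ordIso_Pow_nat show ?thesis
    by (rule ordIso_ordLeq_trans)
qed

corollary continuum_ordLeq_ultraproduct_nat:
  fixes U :: "nat filter"
  assumes U: "nonprincipal_ultrafilter U" and "\<And>i. infinite (dom (\<A> i))"
  shows "ctwo ^c natLeq \<le>o |dom (ultraproduct U \<A>)|"
proof (rule continuum_ordLeq_ultraproduct)
  show "filterlim (\<lambda>n. n) at_top U"
    using nonprincipal_ultrafilter_le_cofinite[OF U]
    by (simp add: filterlim_def filtermap_ident cofinite_eq_sequentially)
qed (use assms nonprincipal_ultrafilter_not_bot in auto)

subsection \<open>Ultrapowers of orders\<close>

abbreviation ultrapower ::
    "'i filter \<Rightarrow> ('f, 'r, 'm) fo_struct \<Rightarrow> ('f, 'r, ('i \<Rightarrow> 'm) set) fo_struct" where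
  "ultrapower U M \<equiv> ultraproduct U (\<lambda>_. M)"

definition diagonal ::
    "'i filter \<Rightarrow> ('f, 'r, 'm) fo_struct \<Rightarrow> 'm \<Rightarrow> ('i \<Rightarrow> 'm) set" where
  "diagonal U M a = ultra_rel U (\<lambda>_. M) `` {\<lambda>_. a}"

lemma diagonal_in_ultrapower:
  assumes "a \<in> dom M"
  shows "diagonal U M a \<in> dom (ultrapower U M)"
  unfolding diagonal_def using assms by (intro ultra_class_in_ultraproduct) simp

lemma rep_diagonal_eventually_eq:
  assumes "a \<in> dom M"
  shows "eventually (\<lambda>i. rep (diagonal U M a) i = a) U"
  using rep_class_eventually_eq[of "\<lambda>_. a" "\<lambda>_. M"] assms by (simp add: diagonal_def)

definition order_lang :: "(nat, nat) language" where
  "order_lang = \<lparr>funs = {}, rels = {0}, fun_arity = (\<lambda>_. 0), rel_arity = (\<lambda>_. 2)\<rparr>"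

definition order_struct :: "'m rel \<Rightarrow> (nat, nat, 'm) fo_struct" where
  "order_struct r =
     \<lparr>dom = Field r, fun_int = (\<lambda>_ _. undefined), rel_int = (\<lambda>_ xs. (xs ! 0, xs ! 1) \<in> r)\<rparr>"

lemma dom_order_struct [simp]: "dom (order_struct r) = Field r"
  by (simp add: order_struct_def)

lemma is_structure_order_struct:
  assumes "Field r \<noteq> {}"
  shows "is_structure order_lang (order_struct r)"
  using assms by (simp add: is_structure_def order_lang_def)

definition above_formula :: "'m \<Rightarrow> (nat + 'm, nat) formula" where
  "above_formula d = Rel 0 [App (Inr d) [], Var 0]"

lemma sat_above_diagonal_iff:
  assumes "a \<in> Field r"
  shows "sat (struct_params (ultrapower U (order_struct r))) (\<lambda>_. c)
           (above_formula (diagonal U (order_struct r) a))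
         \<longleftrightarrow> eventually (\<lambda>i. (a, rep c i) \<in> r) U"
proof -
  let ?d = "diagonal U (order_struct r) a"
  have "eventually (\<lambda>i. rep ?d i = a) U"
    using assms by (intro rep_diagonal_eventually_eq) simp
  then have "eventually (\<lambda>i. (rep ?d i, rep c i) \<in> r \<longleftrightarrow> (a, rep c i) \<in> r) U"
    by eventually_elim simp
  then have "eventually (\<lambda>i. (rep ?d i, rep c i) \<in> r) U \<longleftrightarrow> eventually (\<lambda>i. (a, rep c i) \<in> r) U"
    by (rule eventually_subst)
  then show ?thesis
    by (simp add: above_formula_def struct_params_def ultraproduct_def order_struct_def)
qed

definition above_diagonal_type ::
    "'i filter \<Rightarrow> 'm rel \<Rightarrow> (nat + ('i \<Rightarrow> 'm) set, nat) formula set" where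
  "above_diagonal_type U r = (\<lambda>a. above_formula (diagonal U (order_struct r) a)) ` Field r"

lemma above_diagonal_type_subset:
  "above_diagonal_type U r
     \<subseteq> one_var_formulas order_lang (diagonal U (order_struct r) ` Field r)"
  by (auto simp: above_diagonal_type_def one_var_formulas_def above_formula_def lang_params_def
      order_lang_def)

lemma finitely_satisfiable_above_diagonal_type:
  assumes directed: "\<And>F. finite F \<Longrightarrow> F \<subseteq> Field r \<Longrightarrow> \<exists>b\<in>Field r. \<forall>a\<in>F. (a, b) \<in> r"
  shows "finitely_satisfiable (ultrapower U (order_struct r)) (above_diagonal_type U r)"
  unfolding finitely_satisfiable_def
proof (intro allI impI)
  let ?M = "ultrapower U (order_struct r)" and ?d = "diagonal U (order_struct r)"
  fix q
  assume "q \<subseteq> above_diagonal_type U r \<and> finite q"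
  then have "\<exists>F\<subseteq>Field r. finite F \<and> q = (\<lambda>a. above_formula (?d a)) ` F"
    unfolding above_diagonal_type_def by (intro finite_subset_image) simp_all
  then obtain F where F: "F \<subseteq> Field r" "finite F" "q = (\<lambda>a. above_formula (?d a)) ` F"
    by blast
  obtain b where b: "b \<in> Field r" "\<And>a. a \<in> F \<Longrightarrow> (a, b) \<in> r"
    using directed[OF F(2,1)] by blast
  have ev: "eventually (\<lambda>i. rep (?d b) i = b) U"
    using b(1) by (intro rep_diagonal_eventually_eq) simp
  have "sat (struct_params ?M) (\<lambda>_. ?d b) (above_formula (?d a))" if "a \<in> F" for a
  proof -
    have "eventually (\<lambda>i. (a, rep (?d b) i) \<in> r) U"
      using ev by eventually_elim (simp add: b(2)[OF that])
    then show ?thesis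
      using that F(1) by (subst sat_above_diagonal_iff) auto
  qed
  then have "realizes ?M (?d b) q"
    by (simp add: realizes_def F(3))
  moreover have "?d b \<in> dom ?M"
    using b(1) by (intro diagonal_in_ultrapower) simp
  ultimately show "\<exists>c\<in>dom ?M. realizes ?M c q" ..
qed

lemma not_realizes_above_diagonal_type:
  fixes U :: "'i filter" and r :: "'m rel"
  assumes "U \<noteq> bot"
    and unbounded: "\<And>f :: 'i \<Rightarrow> 'm. range f \<subseteq> Field r \<Longrightarrow> \<exists>a\<in>Field r. \<forall>i. (a, f i) \<notin> r"
    and c: "c \<in> dom (ultrapower U (order_struct r))"
  shows "\<not> realizes (ultrapower U (order_struct r)) c (above_diagonal_type U r)"
proof
  assume real: "realizes (ultrapower U (order_struct r)) c (above_diagonal_type U r)"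
  have "range (rep c) \<subseteq> Field r"
    using rep_in_product[OF c] by auto
  then obtain a where a: "a \<in> Field r" "\<And>i. (a, rep c i) \<notin> r"
    using unbounded by blast
  have "eventually (\<lambda>i. (a, rep c i) \<in> r) U"
    using real a(1) sat_above_diagonal_iff[OF a(1), of U c]
    by (simp add: realizes_def above_diagonal_type_def)
  with a(2) \<open>U \<noteq> bot\<close> show False
    by (simp add: eventually_False)
qed

lemma saturated_ultrapower_regularCard_ordLeq:
  fixes U :: "'i filter"
  assumes r: "Cinfinite r" "regularCard r"
    and U: "U \<noteq> bot" "|UNIV :: 'i set| <o r"
    and sat: "saturated order_lang (ultrapower U (order_struct r))"
  shows "|dom (ultrapower U (order_struct r))| \<le>o r"
proof (rule ccontr)
  let ?M = "ultrapower U (order_struct r)"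
  let ?A = "diagonal U (order_struct r) ` Field r"
  assume "\<not> |dom ?M| \<le>o r"
  then have "r <o |dom ?M|"
    using r(1) not_ordLeq_iff_ordLess[OF _ card_of_Well_order] card_order_on_well_order_on
    by metis
  moreover have "|?A| \<le>o r"
    using card_of_image card_of_Field_ordIso[of r] r(1) ordLeq_ordIso_trans by blast
  ultimately have "|?A| <o |dom ?M|"
    using ordLeq_ordLess_trans by blast
  moreover have "?A \<subseteq> dom ?M"
    by (intro image_subsetI diagonal_in_ultrapower) simp
  moreover have "finitely_satisfiable ?M (above_diagonal_type U r)"
    using Cinfinite_limit_finite[OF _ _ r(1)]
    by (intro finitely_satisfiable_above_diagonal_type) metis
  ultimately have "\<exists>c\<in>dom ?M. realizes ?M c (above_diagonal_type U r)"
    using above_diagonal_type_subset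
    by (intro sat[unfolded saturated_def card_saturated_def, rule_format, of ?A]) simp
  then obtain c where c: "c \<in> dom ?M" "realizes ?M c (above_diagonal_type U r)" ..
  have "\<not> realizes ?M c (above_diagonal_type U r)"
    using U(1) regularCard_range_not_cofinal[OF r _ U(2)] c(1)
    by (rule not_realizes_above_diagonal_type)
  with c(2) show False
    by contradiction
qed

lemma SAT_obtains_saturated_ultrapower:
  fixes r :: "'k rel"
  assumes "SAT r" "Cinfinite r"
  obtains U :: "nat filter" where "nonprincipal_ultrafilter U"
    and "saturated order_lang (ultrapower U (order_struct r))"
proof -
  have "is_structure order_lang (order_struct r)"
    using assms(2) by (intro is_structure_order_struct) (auto simp: cinfinite_def)
  moreover have "|dom (order_struct r)| \<le>o r"
    using assms(2) card_of_Field_ordIso[of r] by (simp add: ordIso_iff_ordLeq)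
  ultimately have admissible:
    "\<forall>i :: nat. is_structure order_lang (order_struct r) \<and> |dom (order_struct r)| \<le>o r"
    by simp
  obtain U :: "nat filter" where U: "nonprincipal_ultrafilter U"
    and sat: "\<And>(L :: (nat, nat) language) (\<A> :: nat \<Rightarrow> (nat, nat, 'k) fo_struct).
      \<forall>i. is_structure L (\<A> i) \<and> |dom (\<A> i)| \<le>o r \<Longrightarrow> saturated L (ultraproduct U \<A>)"
    using assms(1) unfolding SAT_def by blast
  show ?thesis
    using U sat[OF admissible] by (rule that)
qed

theorem theorem2p1:
  assumes "SAT (cardSuc natLeq)"
  shows "ctwo ^c natLeq =o cardSuc natLeq"
proof -
  let ?r = "cardSuc natLeq"
  have r: "Cinfinite ?r" "regularCard ?r"
    using Cinfinite_cardSuc[OF natLeq_Cinfinite] natLeq_Cinfinite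
    by (simp_all add: infinite_cardSuc_regularCard cinfinite_def)
  have countable: "|UNIV :: nat set| <o ?r"
    using card_of_nat cardSuc_greater[OF natLeq_Card_order] by (rule ordIso_ordLess_trans)
  obtain U :: "nat filter" where U: "nonprincipal_ultrafilter U"
    and sat: "saturated order_lang (ultrapower U (order_struct ?r))"
    using SAT_obtains_saturated_ultrapower[OF assms r(1)] .
  have "ctwo ^c natLeq \<le>o |dom (ultrapower U (order_struct ?r))|"
    using r(1) by (intro continuum_ordLeq_ultraproduct_nat U) (simp add: cinfinite_def)
  also have "|dom (ultrapower U (order_struct ?r))| \<le>o ?r"
    using r nonprincipal_ultrafilter_not_bot[OF U] countable sat
    by (rule saturated_ultrapower_regularCard_ordLeq)
  finally show ?thesis
    using cardSuc_ordLeq_ctwo_cexp[OF natLeq_Card_order] by (simp add: ordIso_iff_ordLeq)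
qed

end
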